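(* Let $\mathcal{H}$ be a complex Hilbert space and let $A \in \mathscr{B}(\mathcal{H})$ be a compact normal operator with canonical decomposition $A = \sum_{n \in S} \lambda_n P_n$ (as fixed in the context). If $g \in \mathrm{ran}\, A$, then the inverse linear problem $Af = g$ has a unique Krylov solution (i.e. there is exactly one $f_\circ \in \overline{\mathcal{K}(A,g)}$ with $A f_\circ = g$), and this Krylov solution is of minimal norm among all solutions (i.e. $\|f_\circ\| \le \|f\|$ for every $f \in \mathcal{H}$ with $Af = g$). If in addition $A \neq 0$, then the Krylov solution is $$f_\circ = \sum_{n \in S \setminus \{0\}} \frac{1}{\lambda_n} P_n g .$$
   Context: $\mathscr{B}(\mathcal{H})$ denotes the bounded everywhere defined linear operators on $\mathcal{H}$, and bars over subspaces denote norm closure in $\mathcal{H}$. For $A \in \mathscr{B}(\mathcal{H})$ and $g \in \mathcal{H}$ the Krylov subspace is $\mathcal{K}(A,g) := \mathrm{span}\{A^k g \mid k \in \mathbb{N}_0\}$. A Krylov solution to $Af = g$ (where $g \in \mathrm{ran}\, A$) is a solution $f$ with $f \in \overline{\mathcal{K}(A,g)}$. The series for $f_\circ$ is understood as converging in the norm of $\mathcal{H}$. Canonical decomposition of a compact normal operator $A$: $A = \sum_{n \in S} \lambda_n P_n$ with convergence in operator norm, where $S \subset \mathbb{N}_0$ is an index set with $0 \in S$; $(\lambda_n)_{n \in S \setminus \{0\}}$ are the distinct non-zero eigenvalues of $A$ (with $\lambda_n \to 0$ as $n \to \infty$ if $S$ is infinite); $\lambda_0 = 0$, which need not be an eigenvalue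 of $A$; for $n \in S\setminus\{0\}$, $P_n$ is the orthogonal projection onto the eigenspace $\ker(A - \lambda_n)$ (equivalently, the Riesz projection of $A$ associated with the isolated spectral point $\lambda_n$); $P_0$ is the orthogonal projection onto $\ker A$ (so $P_0 = 0$ when $A$ is injective). The $P_n$ are mutually orthogonal and $\sum_{n \in S} P_n$ equals the identity, with convergence in the strong operator topology. *)

theory Defs
  imports "HOL-Analysis.Analysis"
begin

text \<open>
  The scalar multiplication inherited from \<^class>\<open>real_normed_vector\<close> is the restriction of the
  complex one to the reals. The inner product is antilinear in its first argument.
\<close>

class complex_inner = real_normed_vector +
  fixes scaleC :: "complex \<Rightarrow> 'a \<Rightarrow> 'a"  (infixr "*\<^sub>C" 75)
    and cinner :: "'a \<Rightarrow> 'a \<Rightarrow> complex"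
  assumes scaleR_scaleC: "r *\<^sub>R x = complex_of_real r *\<^sub>C x"
    and scaleC_add_right: "a *\<^sub>C (x + y) = a *\<^sub>C x + a *\<^sub>C y"
    and scaleC_add_left: "(a + b) *\<^sub>C x = a *\<^sub>C x + b *\<^sub>C x"
    and scaleC_scaleC: "a *\<^sub>C (b *\<^sub>C x) = (a * b) *\<^sub>C x"
    and cinner_commute: "cinner x y = cnj (cinner y x)"
    and cinner_add_right: "cinner x (y + z) = cinner x y + cinner x z"
    and cinner_scaleC_right: "cinner x (a *\<^sub>C y) = a * cinner x y"
    and cinner_self: "cinner x x = complex_of_real ((norm x)\<^sup>2)"

class complex_hilbert_space = complex_inner + complete_space

instantiation complex :: complex_hilbert_space
begin

definition scaleC_complex :: "complex \<Rightarrow> complex \<Rightarrow> complex"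
  where "scaleC_complex a x = a * x"

definition cinner_complex :: "complex \<Rightarrow> complex \<Rightarrow> complex"
  where "cinner_complex x y = cnj x * y"

instance
  by standard
    (simp_all add: scaleC_complex_def cinner_complex_def scaleR_conv_of_real algebra_simps
      complex_norm_square del: of_real_power)

end

global_interpretation complex_vector: vector_space "scaleC :: complex \<Rightarrow> 'a \<Rightarrow> 'a::complex_inner"
  defines cspan = complex_vector.span
proof
  show "1 *\<^sub>C x = x" for x :: 'a
    using scaleR_scaleC[of 1 x] by simp
qed (simp_all add: scaleC_add_right scaleC_add_left scaleC_scaleC)

definition bounded_clinear :: "('a::complex_inner \<Rightarrow> 'b::complex_inner) \<Rightarrow> bool"
  where "bounded_clinear A \<longleftrightarrow> bounded_linear A \<and> (\<forall>c x. A (c *\<^sub>C x) = c *\<^sub>C A x)"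

definition compact_operator :: "('a::complex_inner \<Rightarrow> 'b::complex_inner) \<Rightarrow> bool"
  where "compact_operator A \<longleftrightarrow>
    bounded_clinear A \<and> (\<forall>B. bounded B \<longrightarrow> compact (closure (A ` B)))"

definition is_cadjoint :: "('a::complex_inner \<Rightarrow> 'a) \<Rightarrow> ('a \<Rightarrow> 'a) \<Rightarrow> bool"
  where "is_cadjoint A B \<longleftrightarrow> (\<forall>x y. cinner (A x) y = cinner x (B y))"

text \<open>The adjoint of a bounded operator on a Hilbert space exists and is unique, so the quantified
  \<open>B\<close> below is the adjoint of \<open>A\<close>.\<close>

definition normal_operator :: "('a::complex_hilbert_space \<Rightarrow> 'a) \<Rightarrow> bool"
  where "normal_operator A \<longleftrightarrow>
    bounded_clinear A \<and> (\<exists>B. is_cadjoint A B \<and> A \<circ> B = B \<circ> A)"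

definition eigenspace :: "('a::complex_inner \<Rightarrow> 'a) \<Rightarrow> complex \<Rightarrow> 'a set"
  where "eigenspace A c = {x. A x = c *\<^sub>C x}"

definition eigenvalue :: "('a::complex_inner \<Rightarrow> 'a) \<Rightarrow> complex \<Rightarrow> bool"
  where "eigenvalue A c \<longleftrightarrow> (\<exists>x. x \<noteq> 0 \<and> A x = c *\<^sub>C x)"

definition orthogonal_projection_onto :: "'a set \<Rightarrow> ('a::complex_inner \<Rightarrow> 'a) \<Rightarrow> bool"
  where "orthogonal_projection_onto M P \<longleftrightarrow>
    (\<forall>x. P x \<in> M \<and> (\<forall>y\<in>M. cinner y (x - P x) = 0))"

text \<open>
  Since \<open>lam 0 = 0\<close>, the eigenspace belonging to the index \<open>0\<close> is the kernel of \<open>A\<close>, whether or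
  not it is trivial. All sums over \<open>S\<close> are unconditional, that is, limits over the finite subsets
  of \<open>S\<close>; the last two clauses are convergence of the sum in the strong operator topology and in
  the operator norm.
\<close>

definition canonical_decomposition ::
  "('a::complex_hilbert_space \<Rightarrow> 'a) \<Rightarrow> nat set \<Rightarrow> (nat \<Rightarrow> complex) \<Rightarrow> (nat \<Rightarrow> 'a \<Rightarrow> 'a) \<Rightarrow> bool"
  where "canonical_decomposition A S lam P \<longleftrightarrow>
    0 \<in> S \<and> lam 0 = 0 \<and>
    bij_betw lam (S - {0}) {c. c \<noteq> 0 \<and> eigenvalue A c} \<and>
    (infinite S \<longrightarrow> (lam \<longlongrightarrow> 0) (inf sequentially (principal S))) \<and>
    (\<forall>n\<in>S. orthogonal_projection_onto (eigenspace A (lam n)) (P n)) \<and>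
    (\<forall>m\<in>S. \<forall>n\<in>S. m \<noteq> n \<longrightarrow> (\<forall>x. P m (P n x) = 0)) \<and>
    (\<forall>x. ((\<lambda>n. P n x) has_sum x) S) \<and>
    ((\<lambda>F. onorm (\<lambda>x. A x - (\<Sum>n\<in>F. lam n *\<^sub>C P n x))) \<longlongrightarrow> 0) (finite_subsets_at_top S)"

definition krylov_subspace :: "('a::complex_inner \<Rightarrow> 'a) \<Rightarrow> 'a \<Rightarrow> 'a set"
  where "krylov_subspace A g = cspan {(A ^^ k) g | k. True}"

definition krylov_solution :: "('a::complex_inner \<Rightarrow> 'a) \<Rightarrow> 'a \<Rightarrow> 'a \<Rightarrow> bool"
  where "krylov_solution A g f \<longleftrightarrow> A f = g \<and> f \<in> closure (krylov_subspace A g)"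

end

theory Submission
  imports Defs
begin

text \<open>
  If \<open>A f = g\<close>, then \<open>P n g = lam n *\<^sub>C P n f\<close>, so the claimed series is the expansion of \<open>f - P 0 f\<close>.
  It lies in the closed Krylov subspace because every \<open>P n g\<close> with \<open>lam n \<noteq> 0\<close> does. This follows
  by induction on the number of eigenvalues of larger modulus: once the components of \<open>g\<close> for these
  have been subtracted, the powers of \<open>(1 + A / lam n) / 2\<close>, which has eigenvalue \<open>1\<close> on the
  eigenspace of \<open>lam n\<close> and eigenvalues of modulus less than \<open>1\<close> on the others, applied to the
  remainder converge to \<open>P n g\<close>. Uniqueness and minimality hold because the closed Krylov subspace is
  orthogonal to the kernel of \<open>A\<close>.
\<close>

section \<open>Geometry and continuity of the complex inner product\<close>

lemma bounded_clinear_bounded_linear: "bounded_clinear A \<Longrightarrow> bounded_linear A"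
  by (simp add: bounded_clinear_def)

lemma bounded_clinear_scaleC: "bounded_clinear A \<Longrightarrow> A (c *\<^sub>C x) = c *\<^sub>C A x"
  by (simp add: bounded_clinear_def)

lemma cinner_add_left: "cinner (x + y) z = cinner x z + cinner y z"
  for x y z :: "'a::complex_inner"
  by (metis cinner_add_right cinner_commute complex_cnj_add)

lemma cinner_scaleC_left: "cinner (a *\<^sub>C x) y = cnj a * cinner x y"
  for x y :: "'a::complex_inner"
  by (metis cinner_scaleC_right cinner_commute complex_cnj_mult)

lemma cinner_eq_zero_sym: "cinner x y = 0 \<longleftrightarrow> cinner y x = 0"
  for x y :: "'a::complex_inner"
  by (metis cinner_commute complex_cnj_zero)

lemma cinner_self_eq_zero_iff: "cinner x x = 0 \<longleftrightarrow> x = 0"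
  for x :: "'a::complex_inner"
  by (simp add: cinner_self)

text \<open>The class axioms tie the norm to non-real scalars only through
  \<open>cinner_self\<close>, so the identity is read off from the inner product of the scaled
  vector with itself.\<close>

lemma norm_scaleC: "norm (c *\<^sub>C x) = cmod c * norm x"
  for x :: "'a::complex_inner"
proof -
  have "complex_of_real ((norm (c *\<^sub>C x))\<^sup>2) = (cnj c * c) * complex_of_real ((norm x)\<^sup>2)"
    by (metis cinner_self cinner_scaleC_left cinner_scaleC_right mult.assoc mult.left_commute)
  also have "\<dots> = complex_of_real ((cmod c * norm x)\<^sup>2)"
    by (simp only: mult.commute[of "cnj c"] complex_norm_square[symmetric] of_real_mult[symmetric]
        of_real_power[symmetric] power_mult_distrib)
  finally have "(norm (c *\<^sub>C x))\<^sup>2 = (cmod c * norm x)\<^sup>2"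
    using of_real_eq_iff by blast
  then show ?thesis
    by (simp add: power2_eq_iff_nonneg)
qed

lemma norm_add_orthogonal:
  fixes x y :: "'a::complex_inner"
  assumes "cinner x y = 0"
  shows "(norm (x + y))\<^sup>2 = (norm x)\<^sup>2 + (norm y)\<^sup>2"
proof -
  have "cinner y x = 0"
    using assms cinner_eq_zero_sym by blast
  then have "cinner (x + y) (x + y) = cinner x x + cinner y y"
    using assms by (simp add: cinner_add_left cinner_add_right)
  then have "complex_of_real ((norm (x + y))\<^sup>2) = complex_of_real ((norm x)\<^sup>2 + (norm y)\<^sup>2)"
    by (simp only: cinner_self of_real_add)
  then show ?thesis
    using of_real_eq_iff by blast
qed

lemma norm_le_norm_add_orthogonal:
  fixes x y :: "'a::complex_inner"
  assumes "cinner x y = 0"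
  shows "norm x \<le> norm (x + y)"
  by (rule power2_le_imp_le) (simp_all add: norm_add_orthogonal[OF assms])

text \<open>Cauchy-Schwarz, obtained from Pythagoras; it makes the inner product continuous in its
  second argument.\<close>

lemma norm_cinner_le: "cmod (cinner x y) \<le> norm x * norm y"
  for x y :: "'a::complex_inner"
proof (cases "x = 0")
  case True
  then show ?thesis
    by (metis cinner_scaleC_left complex_cnj_zero complex_vector.scale_zero_left mult_zero_left
        norm_zero order_refl)
next
  case False
  define c where "c = cinner x y"
  \<comment> \<open>This is the component of \<open>y\<close> orthogonal to \<open>x\<close>,
    multiplied by the squared norm of \<open>x\<close> to avoid a division.\<close>
  define z where "z = complex_of_real ((norm x)\<^sup>2) *\<^sub>C y + (- c) *\<^sub>C x"
  have "cinner x z = 0"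
    by (simp only: z_def cinner_add_right cinner_scaleC_right cinner_self c_def) simp
  then have "cinner (c *\<^sub>C x) z = 0"
    by (simp add: cinner_scaleC_left)
  then have "norm (c *\<^sub>C x) \<le> norm (c *\<^sub>C x + z)"
    by (rule norm_le_norm_add_orthogonal)
  also have "c *\<^sub>C x + z = complex_of_real ((norm x)\<^sup>2) *\<^sub>C y"
    by (simp add: z_def complex_vector.scale_minus_left)
  finally have "cmod c * norm x \<le> (norm x)\<^sup>2 * norm y"
    by (simp add: norm_scaleC del: of_real_power)
  then have "cmod c * norm x \<le> (norm x * norm y) * norm x"
    by (simp add: power2_eq_square mult_ac)
  then show ?thesis
    using False by (simp add: c_def mult.commute)
qed

lemma bounded_linear_cinner_right: "bounded_linear (cinner x)"
  for x :: "'a::complex_inner"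
proof (rule bounded_linear_intro)
  show "cinner x (r *\<^sub>R y) = r *\<^sub>R cinner x y" for r y
    by (simp add: scaleR_scaleC[of r y] cinner_scaleC_right scaleR_conv_of_real)
  show "norm (cinner x y) \<le> norm y * norm x" for y
    using norm_cinner_le[of x y] by (simp add: mult.commute)
qed (rule cinner_add_right)

lemma bounded_linear_scaleC_right: "bounded_linear (\<lambda>x::'a::complex_inner. c *\<^sub>C x)"
proof (rule bounded_linear_intro)
  show "c *\<^sub>C (r *\<^sub>R y) = r *\<^sub>R (c *\<^sub>C y)" for r and y :: 'a
    by (simp only: scaleR_scaleC scaleC_scaleC mult.commute)
  show "norm (c *\<^sub>C y) \<le> norm y * cmod c" for y :: 'a
    by (simp add: norm_scaleC mult.commute)
qed (rule scaleC_add_right)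

lemma cinner_diff_right: "cinner x (y - z) = cinner x y - cinner x z"
  for x y z :: "'a::complex_inner"
  by (rule linear_diff[OF bounded_linear.linear[OF bounded_linear_cinner_right]])

lemma cinner_zero_right: "cinner x 0 = 0"
  for x :: "'a::complex_inner"
  by (rule linear_0[OF bounded_linear.linear[OF bounded_linear_cinner_right]])

lemma cinner_sum_right: "cinner x (sum v F) = (\<Sum>i\<in>F. cinner x (v i))"
  for x :: "'a::complex_inner"
  by (rule linear_sum[OF bounded_linear.linear[OF bounded_linear_cinner_right]])

lemma cinner_has_sum_eq_zero:
  fixes v :: "'i \<Rightarrow> 'a::complex_inner"
  assumes "(v has_sum z) I" and "\<And>i. i \<in> I \<Longrightarrow> cinner x (v i) = 0"
  shows "cinner x z = 0"
proof -
  have "((\<lambda>i. cinner x (v i)) has_sum cinner x z) I"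
    using has_sum_bounded_linear[OF bounded_linear_cinner_right assms(1)] .
  moreover have "((\<lambda>i. cinner x (v i)) has_sum 0) I"
    using assms(2) by (rule has_sum_0)
  ultimately show ?thesis
    by (rule has_sum_unique)
qed

lemma closed_orthogonal: "closed {x::'a::complex_inner. cinner y x = 0}"
  by (intro closed_Collect_eq continuous_on_const linear_continuous_on bounded_linear_cinner_right)

section \<open>Closures of complex subspaces and series in closed subspaces\<close>

lemma complex_subspace_closure:
  fixes K :: "'a::complex_inner set"
  assumes "complex_vector.subspace K"
  shows "complex_vector.subspace (closure K)"
proof (rule complex_vector.subspaceI)
  show "0 \<in> closure K"
    using complex_vector.subspace_0[OF assms] closure_subset by blast
next
  fix x y assume "x \<in> closure K" "y \<in> closure K"
  then obtain u v where u: "\<forall>n. u n \<in> K" "u \<longlonglongrightarrow> x" and v: "\<forall>n. v n \<in> K" "v \<longlonglongrightarrow> y"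
    by (auto simp: closure_sequential)
  have "(\<lambda>n. u n + v n) \<longlonglongrightarrow> x + y"
    using u(2) v(2) by (rule tendsto_add)
  moreover have "u n + v n \<in> K" for n
    using u(1) v(1) by (simp add: complex_vector.subspace_add[OF assms])
  ultimately show "x + y \<in> closure K"
    unfolding closure_sequential by (intro exI[of _ "\<lambda>n. u n + v n"] conjI allI)
next
  fix c x assume "x \<in> closure K"
  moreover have "(\<lambda>x. c *\<^sub>C x) ` closure K \<subseteq> closure ((\<lambda>x. c *\<^sub>C x) ` K)"
    by (rule closure_bounded_linear_image_subset[OF bounded_linear_scaleC_right])
  moreover have "(\<lambda>x. c *\<^sub>C x) ` K \<subseteq> K"
    using complex_vector.subspace_scale[OF assms] by blast
  ultimately show "c *\<^sub>C x \<in> closure K"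
    using closure_mono by blast
qed

lemma has_sum_in_closed_subspace:
  fixes v :: "'i \<Rightarrow> 'a::complex_inner"
  assumes "complex_vector.subspace M" "closed M" and "(v has_sum z) I"
    and "\<And>i. i \<in> I \<Longrightarrow> v i \<in> M"
  shows "z \<in> M"
proof (rule Lim_in_closed_set[OF assms(2)])
  show "(sum v \<longlongrightarrow> z) (finite_subsets_at_top I)"
    using assms(3) by (simp add: has_sum_def)
  show "\<forall>\<^sub>F F in finite_subsets_at_top I. sum v F \<in> M"
    using assms(1,4) by (intro eventually_finite_subsets_at_top_weakI complex_vector.subspace_sum) auto
qed simp

section \<open>Orthogonal series\<close>

abbreviation orthogonal_family :: "('i \<Rightarrow> 'a::complex_inner) \<Rightarrow> 'i set \<Rightarrow> bool"
  where "orthogonal_family v I \<equiv> pairwise (\<lambda>i j. cinner (v i) (v j) = 0) I"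

lemma norm_sum_orthogonal:
  fixes v :: "'i \<Rightarrow> 'a::complex_inner"
  assumes "finite F" "orthogonal_family v F"
  shows "(norm (sum v F))\<^sup>2 = (\<Sum>i\<in>F. (norm (v i))\<^sup>2)"
  using assms
proof (induction F rule: finite_induct)
  case (insert i F)
  have "cinner (v i) (sum v F) = 0"
    unfolding cinner_sum_right using insert by (intro sum.neutral) (auto simp: pairwise_insert)
  then show ?case
    using insert by (simp add: norm_add_orthogonal pairwise_insert)
qed simp

text \<open>By Pythagoras the squared norm of a finite partial sum is the sum of the squared norms
  of its terms, so multipliers of modulus at most one can only shrink it. The inequality survives
  the limit over finite subsets.\<close>

lemma norm_orthogonal_series_le:
  fixes v :: "'i \<Rightarrow> 'a::complex_inner"
  assumes orth: "orthogonal_family v I" and c: "\<And>i. i \<in> I \<Longrightarrow> cmod (c i) \<le> 1"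
    and z: "(v has_sum z) I" and w: "((\<lambda>i. c i *\<^sub>C v i) has_sum w) I"
  shows "norm w \<le> norm z"
proof (rule tendsto_le)
  show "((\<lambda>F. norm (sum v F)) \<longlongrightarrow> norm z) (finite_subsets_at_top I)"
    using z by (intro tendsto_norm) (simp add: has_sum_def)
  show "((\<lambda>F. norm (\<Sum>i\<in>F. c i *\<^sub>C v i)) \<longlongrightarrow> norm w) (finite_subsets_at_top I)"
    using w by (intro tendsto_norm) (simp add: has_sum_def)
  have "norm (\<Sum>i\<in>F. c i *\<^sub>C v i) \<le> norm (sum v F)" if F: "finite F" "F \<subseteq> I" for F
  proof (rule power2_le_imp_le)
    have o: "orthogonal_family v F"
      using orth F(2) by (rule pairwise_subset)
    then have "orthogonal_family (\<lambda>i. c i *\<^sub>C v i) F"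
      by (auto simp: pairwise_def cinner_scaleC_left cinner_scaleC_right)
    then have "(norm (\<Sum>i\<in>F. c i *\<^sub>C v i))\<^sup>2 = (\<Sum>i\<in>F. (cmod (c i) * norm (v i))\<^sup>2)"
      by (simp add: norm_sum_orthogonal[OF F(1)] norm_scaleC)
    also have "\<dots> \<le> (\<Sum>i\<in>F. (norm (v i))\<^sup>2)"
      using c F(2) by (intro sum_mono power_mono mult_left_le_one_le) auto
    also have "\<dots> = (norm (sum v F))\<^sup>2"
      using norm_sum_orthogonal[OF F(1) o] by simp
    finally show "(norm (\<Sum>i\<in>F. c i *\<^sub>C v i))\<^sup>2 \<le> (norm (sum v F))\<^sup>2" .
  qed simp
  then show "\<forall>\<^sub>F F in finite_subsets_at_top I. norm (\<Sum>i\<in>F. c i *\<^sub>C v i) \<le> norm (sum v F)"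
    by (intro eventually_finite_subsets_at_top_weakI) blast
qed simp

text \<open>A dominated convergence argument: outside a finite set \<open>F\<close> the series is
  small uniformly in \<open>k\<close>, and on \<open>F\<close> the finitely many multipliers tend to
  zero.\<close>

lemma orthogonal_series_tendsto_zero:
  fixes v :: "'i \<Rightarrow> 'a::complex_inner" and c :: "nat \<Rightarrow> 'i \<Rightarrow> complex"
  assumes orth: "orthogonal_family v I" and z: "(v has_sum z) I"
    and c_le: "\<And>k i. i \<in> I \<Longrightarrow> cmod (c k i) \<le> 1"
    and c_lim: "\<And>i. i \<in> I \<Longrightarrow> (\<lambda>k. c k i) \<longlonglongrightarrow> 0"
    and w: "\<And>k. ((\<lambda>i. c k i *\<^sub>C v i) has_sum w k) I"
  shows "w \<longlonglongrightarrow> 0"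
proof (rule tendstoI)
  fix e :: real assume "0 < e"
  then have "0 < e / 2" by simp
  moreover have "(sum v \<longlongrightarrow> z) (finite_subsets_at_top I)"
    using z by (simp add: has_sum_def)
  ultimately have "\<forall>\<^sub>F F in finite_subsets_at_top I. dist (sum v F) z < e / 2"
    by (metis tendstoD)
  then obtain F where F: "finite F" "F \<subseteq> I" and small: "dist (sum v F) z < e / 2"
    unfolding eventually_finite_subsets_at_top by blast
  \<comment> \<open>Since all multipliers have modulus at most one, the remainder beyond
    \<open>F\<close> is controlled by that of the unweighted series, whatever \<open>k\<close>
    is.\<close>
  have tail: "norm (w k - (\<Sum>i\<in>F. c k i *\<^sub>C v i)) \<le> norm (z - sum v F)" for k
  proof (rule norm_orthogonal_series_le)
    show "orthogonal_family v (I - F)"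
      using orth by (rule pairwise_subset) blast
    show "(v has_sum z - sum v F) (I - F)"
      using z F by (intro has_sum_Diff has_sum_finite)
    show "((\<lambda>i. c k i *\<^sub>C v i) has_sum w k - (\<Sum>i\<in>F. c k i *\<^sub>C v i)) (I - F)"
      using w F by (intro has_sum_Diff has_sum_finite)
  qed (use c_le in blast)
  have "(\<lambda>k. \<Sum>i\<in>F. cmod (c k i) * norm (v i)) \<longlonglongrightarrow> 0"
    using c_lim F(2) by (intro tendsto_null_sum tendsto_mult_left_zero tendsto_norm_zero) blast
  from order_tendstoD(2)[OF this \<open>0 < e / 2\<close>]
  show "\<forall>\<^sub>F k in sequentially. dist (w k) 0 < e"
  proof eventually_elim
    case (elim k)
    have "norm (\<Sum>i\<in>F. c k i *\<^sub>C v i) \<le> (\<Sum>i\<in>F. cmod (c k i) * norm (v i))"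
      by (rule order_trans[OF norm_sum]) (simp add: norm_scaleC)
    moreover have "norm (w k) \<le> norm (w k - (\<Sum>i\<in>F. c k i *\<^sub>C v i)) + norm (\<Sum>i\<in>F. c k i *\<^sub>C v i)"
      by (metis diff_add_cancel norm_triangle_ineq)
    moreover have "norm (z - sum v F) < e / 2"
      using small by (simp add: dist_norm norm_minus_commute)
    ultimately show ?case
      using tail[of k] elim by simp
  qed
qed

section \<open>Krylov subspaces\<close>

lemma subspace_closure_krylov: "complex_vector.subspace (closure (krylov_subspace A g))"
  unfolding krylov_subspace_def by (intro complex_subspace_closure complex_vector.subspace_span)

lemma krylov_subspace_minimal:
  assumes "complex_vector.subspace M" and "\<And>k. (A ^^ k) g \<in> M"
  shows "krylov_subspace A g \<subseteq> M"
  unfolding krylov_subspace_def using assms by (intro complex_vector.span_minimal) auto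

lemma funpow_in_krylov_subspace: "(A ^^ k) g \<in> krylov_subspace A g"
  unfolding krylov_subspace_def by (rule complex_vector.span_base) blast

text \<open>\<open>A\<close> shifts the generating powers by one, hence maps their span into itself;
  continuity extends this to the closure.\<close>

lemma closure_krylov_invariant:
  assumes A: "bounded_clinear A" and x: "x \<in> closure (krylov_subspace A g)"
  shows "A x \<in> closure (krylov_subspace A g)"
proof -
  let ?K = "krylov_subspace A g"
  have sub: "complex_vector.subspace ?K"
    unfolding krylov_subspace_def by (rule complex_vector.subspace_span)
  have lin: "linear A"
    using A by (simp add: bounded_clinear_def bounded_linear.linear)
  have "?K \<subseteq> {x. A x \<in> ?K}"
  proof (rule krylov_subspace_minimal)
    show "complex_vector.subspace {x. A x \<in> ?K}"
      using sub by (intro complex_vector.subspaceI)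
        (auto simp: linear_0[OF lin] linear_add[OF lin] bounded_clinear_scaleC[OF A]
          complex_vector.subspace_0 complex_vector.subspace_add complex_vector.subspace_scale)
    show "(A ^^ k) g \<in> {x. A x \<in> ?K}" for k
      using funpow_in_krylov_subspace[of "Suc k" A g] by simp
  qed
  then have "A ` ?K \<subseteq> ?K" by blast
  then have "closure (A ` ?K) \<subseteq> closure ?K"
    by (rule closure_mono)
  moreover have "A ` closure ?K \<subseteq> closure (A ` ?K)"
    by (rule closure_bounded_linear_image_subset[OF bounded_clinear_bounded_linear[OF A]])
  ultimately show ?thesis
    using x by blast
qed

section \<open>The canonical decomposition\<close>

lemma subspace_eigenspace:
  assumes "bounded_clinear A"
  shows "complex_vector.subspace (eigenspace A c)"
proof -
  have lin: "linear A"
    using assms by (simp add: bounded_clinear_def bounded_linear.linear)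
  show ?thesis
    by (rule complex_vector.subspaceI)
      (auto simp: eigenspace_def linear_0[OF lin] linear_add[OF lin] bounded_clinear_scaleC[OF assms]
        complex_vector.scale_right_distrib complex_vector.scale_left_commute)
qed

text \<open>Uniqueness of the orthogonal projection: \<open>u - P x\<close> lies in \<open>M\<close>
  and, as a difference of two residuals, is orthogonal to \<open>M\<close>, hence to itself.\<close>

lemma orthogonal_projection_onto_eqI:
  assumes "complex_vector.subspace M" "orthogonal_projection_onto M P"
    and "u \<in> M" and "\<And>y. y \<in> M \<Longrightarrow> cinner y (x - u) = 0"
  shows "P x = u"
proof -
  have P: "P x \<in> M" "\<And>y. y \<in> M \<Longrightarrow> cinner y (x - P x) = 0"
    using assms(2) by (auto simp: orthogonal_projection_onto_def)
  have "u - P x \<in> M"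
    using assms(1,3) P(1) by (rule complex_vector.subspace_diff)
  then have "cinner (u - P x) ((x - P x) - (x - u)) = 0"
    using P(2) assms(4) cinner_diff_right by (metis diff_zero)
  then show ?thesis
    by (simp add: cinner_self_eq_zero_iff)
qed

text \<open>Strict convexity of the disc: the midpoint of \<open>1\<close> and a different point of
  the closed unit disc lies in the open disc.\<close>

lemma norm_midpoint_one_less_one:
  assumes "cmod w \<le> 1" "w \<noteq> 1"
  shows "cmod ((1 + w) / 2) < 1"
proof -
  have sq: "(Re w)\<^sup>2 + (Im w)\<^sup>2 \<le> 1"
    using assms(1) by (metis cmod_power2 norm_ge_zero power_le_one)
  have "Re w < 1"
  proof (rule ccontr)
    assume "\<not> Re w < 1"
    then have "1 \<le> (Re w)\<^sup>2" by (simp add: one_le_power)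
    moreover have "0 \<le> (Im w)\<^sup>2" by simp
    ultimately have "(Re w)\<^sup>2 = 1" "(Im w)\<^sup>2 = 0" using sq by linarith+
    then have "w = 1"
      using \<open>\<not> Re w < 1\<close> by (auto simp: complex_eq_iff power2_eq_1_iff)
    then show False using assms(2) by simp
  qed
  have "(cmod (1 + w))\<^sup>2 = 1 + 2 * Re w + ((Re w)\<^sup>2 + (Im w)\<^sup>2)"
    by (simp add: cmod_power2 power2_sum)
  also have "\<dots> < 2\<^sup>2"
    using sq \<open>Re w < 1\<close> by simp
  finally have "cmod (1 + w) < 2"
    by (rule power2_less_imp_less) simp
  then show ?thesis
    by (simp add: norm_divide)
qed

locale canonically_decomposed =
  fixes A :: "'a::complex_hilbert_space \<Rightarrow> 'a" and S lam P
  assumes bounded: "bounded_clinear A"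
    and decomposition: "canonical_decomposition A S lam P"
begin

section \<open>Orthogonality of the eigenspaces and the spectral expansion of
  \<open>A\<close>\<close>

lemma zero_index: "0 \<in> S" "lam 0 = 0"
  using decomposition by (auto simp: canonical_decomposition_def)

lemma lam_nonzero: "n \<in> S - {0} \<Longrightarrow> lam n \<noteq> 0"
  using decomposition by (auto simp: canonical_decomposition_def bij_betw_def)

text \<open>The non-zero eigenvalues are enumerated without repetition, and \<open>lam 0 = 0\<close>
  differs from all of them.\<close>

lemma inj_on_lam: "inj_on lam S"
proof -
  have "inj_on lam (S - {0})"
    using decomposition by (auto simp: canonical_decomposition_def bij_betw_def)
  then have "inj_on lam (insert 0 (S - {0}))"
    unfolding inj_on_insert using lam_nonzero zero_index by fastforce
  then show ?thesis
    using zero_index by (simp add: insert_absorb)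
qed

lemma projection: "n \<in> S \<Longrightarrow> orthogonal_projection_onto (eigenspace A (lam n)) (P n)"
  using decomposition by (auto simp: canonical_decomposition_def)

lemma projection_in_eigenspace: "n \<in> S \<Longrightarrow> P n x \<in> eigenspace A (lam n)"
  using projection by (auto simp: orthogonal_projection_onto_def)

lemma A_projection: "n \<in> S \<Longrightarrow> A (P n x) = lam n *\<^sub>C P n x"
  using projection_in_eigenspace by (auto simp: eigenspace_def)

lemma has_sum_projections: "((\<lambda>n. P n x) has_sum x) S"
  using decomposition by (auto simp: canonical_decomposition_def)

text \<open>\<open>P n\<close> fixes \<open>z\<close>, so \<open>P m z = P m (P n z) = 0\<close>.
  Thus \<open>z\<close> equals its own residual \<open>z - P m z\<close>, which is orthogonal to the
  eigenspace containing \<open>y\<close>.\<close>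

lemma eigenspaces_orthogonal:
  assumes "m \<in> S" "n \<in> S" "m \<noteq> n"
    and y: "y \<in> eigenspace A (lam m)" and z: "z \<in> eigenspace A (lam n)"
  shows "cinner y z = 0"
proof -
  have "P n z = z"
    using subspace_eigenspace[OF bounded] projection[OF assms(2)] z
    by (rule orthogonal_projection_onto_eqI) (simp add: cinner_zero_right)
  moreover have "P m (P n z) = 0"
    using decomposition assms(1-3) by (auto simp: canonical_decomposition_def)
  ultimately have "P m z = 0" by simp
  moreover have "cinner y (z - P m z) = 0"
    using projection[OF assms(1)] y by (auto simp: orthogonal_projection_onto_def)
  ultimately show ?thesis by simp
qed

lemma orthogonal_family_projections: "orthogonal_family (\<lambda>n. P n x) S"
  using eigenspaces_orthogonal projection_in_eigenspace by (auto simp: pairwise_def)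

lemma has_sum_A: "((\<lambda>n. lam n *\<^sub>C P n x) has_sum A x) S"
  using has_sum_bounded_linear[OF bounded_clinear_bounded_linear[OF bounded] has_sum_projections[of x]]
  by (simp add: A_projection cong: has_sum_cong)

text \<open>Removing the term \<open>n\<close> from the expansion of \<open>A x\<close> leaves a
  series of vectors in the other eigenspaces, so the residual is orthogonal to the eigenspace of
  \<open>lam n\<close>.\<close>

lemma projection_A:
  assumes "n \<in> S"
  shows "P n (A x) = lam n *\<^sub>C P n x"
  using subspace_eigenspace[OF bounded] projection[OF assms]
proof (rule orthogonal_projection_onto_eqI)
  show "lam n *\<^sub>C P n x \<in> eigenspace A (lam n)"
    using subspace_eigenspace[OF bounded] projection_in_eigenspace[OF assms]
    by (rule complex_vector.subspace_scale)
  fix y assume y: "y \<in> eigenspace A (lam n)"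
  have "((\<lambda>m. lam m *\<^sub>C P m x) has_sum A x - (\<Sum>m\<in>{n}. lam m *\<^sub>C P m x)) (S - {n})"
    using has_sum_A assms by (intro has_sum_Diff has_sum_finite) auto
  moreover have "cinner y (lam m *\<^sub>C P m x) = 0" if "m \<in> S - {n}" for m
    using eigenspaces_orthogonal[OF assms _ _ y projection_in_eigenspace, of m] that
    by (auto simp: cinner_scaleC_right)
  ultimately have "cinner y (A x - (\<Sum>m\<in>{n}. lam m *\<^sub>C P m x)) = 0"
    by (rule cinner_has_sum_eq_zero)
  then show "cinner y (A x - lam n *\<^sub>C P n x) = 0"
    by simp
qed

text \<open>The kernel is the eigenspace of index \<open>0\<close>. In the expansion of
  \<open>A x\<close> the term of index \<open>0\<close> vanishes, and every other term lies in an
  eigenspace orthogonal to the kernel.\<close>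

lemma range_orthogonal_kernel:
  assumes "A y = 0"
  shows "cinner y (A x) = 0"
proof -
  have y: "y \<in> eigenspace A (lam 0)"
    using assms by (simp add: eigenspace_def zero_index)
  have "cinner y (lam n *\<^sub>C P n x) = 0" if "n \<in> S" for n
  proof (cases "n = 0")
    case True
    then show ?thesis by (simp add: zero_index cinner_zero_right)
  next
    case False
    then show ?thesis
      using eigenspaces_orthogonal[OF zero_index(1) that _ y projection_in_eigenspace[OF that]]
      by (simp add: cinner_scaleC_right)
  qed
  with has_sum_A show ?thesis
    by (rule cinner_has_sum_eq_zero)
qed

section \<open>Spectral components of \<open>g\<close> in the closed Krylov subspace\<close>

lemma finite_larger_eigenvalues:
  assumes "0 < r"
  shows "finite {m \<in> S. r < cmod (lam m)}"
proof (cases "finite S")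
  case False
  then have "(lam \<longlongrightarrow> 0) (inf sequentially (principal S))"
    using decomposition by (auto simp: canonical_decomposition_def)
  then have "\<forall>\<^sub>F m in inf sequentially (principal S). dist (lam m) 0 < r"
    using assms by (rule tendstoD)
  then obtain N where N: "cmod (lam m) < r" if "m \<ge> N" "m \<in> S" for m
    by (auto simp: eventually_inf_principal eventually_sequentially)
  have "m < N" if "m \<in> S" "r < cmod (lam m)" for m
    using that N[of m] by (cases "m < N") auto
  then show ?thesis
    by (intro finite_subset[OF _ finite_lessThan[of N]]) auto
qed simp

lemma projection_in_closure_krylov:
  assumes "n \<in> S - {0}"
  shows "P n g \<in> closure (krylov_subspace A g)"
  using assms
proof (induction "card {m \<in> S. cmod (lam n) < cmod (lam m)}" arbitrary: n rule: less_induct)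
  case less
  let ?M = "closure (krylov_subspace A g)"
  have n: "n \<in> S" "lam n \<noteq> 0"
    using less.prems lam_nonzero by auto
  note sub = subspace_closure_krylov[of A g]
  \<comment> \<open>Only strictly larger moduli are removed; infinitely many could not be subtracted
    as a finite sum, but \<open>lam n\<close> is non-zero and the eigenvalues accumulate at most at
    zero. Eigenvalues of the same modulus as \<open>lam n\<close> are left to
    \<open>T\<close>.\<close>
  define B where "B = {m \<in> S. cmod (lam n) < cmod (lam m)}"
  have B: "finite B" "B \<subseteq> S" "n \<notin> B"
    using finite_larger_eigenvalues[of "cmod (lam n)"] n by (auto simp: B_def)
  have larger: "P m g \<in> ?M" if m: "m \<in> B" for m
  proof (rule less.hyps)
    \<comment> \<open>The inclusion is strict because \<open>m\<close> itself belongs to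
      \<open>B\<close> but not to the left-hand set; this makes the induction measure drop.\<close>
    have "{j \<in> S. cmod (lam m) < cmod (lam j)} \<subset> B"
      using m by (auto simp: B_def)
    then show "card {j \<in> S. cmod (lam m) < cmod (lam j)} < card {j \<in> S. cmod (lam n) < cmod (lam j)}"
      using psubset_card_mono[OF B(1)] by (simp add: B_def)
    show "m \<in> S - {0}"
      using m by (auto simp: B_def zero_index intro: gr0I)
  qed
  define y where "y = g - (\<Sum>m\<in>B. P m g)"
  have y_sum: "((\<lambda>m. P m g) has_sum y) (S - B)"
    unfolding y_def using has_sum_projections B by (intro has_sum_Diff has_sum_finite)
  have "g \<in> ?M"
    using funpow_in_krylov_subspace[of 0 A g] closure_subset[of "krylov_subspace A g"] by auto
  then have y_M: "y \<in> ?M"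
    unfolding y_def using sub larger
    by (intro complex_vector.subspace_diff complex_vector.subspace_sum)
  \<comment> \<open>\<open>A / lam n\<close> alone may have further eigenvalues on the unit circle,
    whose powers do not decay. Averaging with the identity keeps the eigenvalue \<open>1\<close> and
    moves the others into the open disc. \<open>mu m\<close> is the resulting eigenvalue of
    \<open>T\<close> on the eigenspace of index \<open>m\<close>.\<close>
  define T where "T = (\<lambda>x. (1 / 2) *\<^sub>C (x + (1 / lam n) *\<^sub>C A x))"
  define mu where "mu m = (1 + lam m / lam n) / 2" for m
  have T_linear: "bounded_linear T"
    unfolding T_def
    by (intro bounded_linear_compose[OF bounded_linear_scaleC_right] bounded_linear_add
        bounded_linear_ident bounded_clinear_bounded_linear[OF bounded])
  have T_scaleC: "T (c *\<^sub>C x) = c *\<^sub>C T x" for c x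
    by (simp add: T_def bounded_clinear_scaleC[OF bounded] complex_vector.scale_right_distrib mult_ac)
  have T_P: "T (P m x) = mu m *\<^sub>C P m x" if "m \<in> S" for m x
  proof -
    have "P m x + (1 / lam n) *\<^sub>C A (P m x) = (1 + lam m / lam n) *\<^sub>C P m x"
      using that by (simp add: A_projection complex_vector.scale_left_distrib)
    then show ?thesis
      by (simp add: T_def mu_def)
  qed
  have T_M: "T x \<in> ?M" if "x \<in> ?M" for x
    unfolding T_def using sub that closure_krylov_invariant[OF bounded that]
    by (intro complex_vector.subspace_scale complex_vector.subspace_add)
  \<comment> \<open>\<open>T\<close> is continuous and acts on each component as multiplication by
    \<open>mu m\<close>, so its powers can be applied to the expansion of \<open>y\<close> term by
    term.\<close>
  have powers_sum: "((\<lambda>m. mu m ^ k *\<^sub>C P m g) has_sum (T ^^ k) y) (S - B)" for k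
  proof (induction k)
    case 0
    then show ?case using y_sum by simp
  next
    case (Suc k)
    have "((\<lambda>m. T (mu m ^ k *\<^sub>C P m g)) has_sum T ((T ^^ k) y)) (S - B)"
      by (rule has_sum_bounded_linear[OF T_linear Suc])
    moreover have "T (mu m ^ k *\<^sub>C P m g) = mu m ^ Suc k *\<^sub>C P m g" if "m \<in> S - B" for m
      using that by (simp add: T_scaleC T_P mult.commute)
    ultimately have "((\<lambda>m. mu m ^ Suc k *\<^sub>C P m g) has_sum T ((T ^^ k) y)) (S - B)"
      by (rule has_sum_cong[THEN iffD1, rotated])
    then show ?case
      by simp
  qed
  have powers_M: "(T ^^ k) y \<in> ?M" for k
    by (induction k) (auto simp: y_M T_M)
  have mu_n: "mu n = 1"
    using n by (simp add: mu_def)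
  have mu_less: "cmod (mu m) < 1" if m: "m \<in> S - B - {n}" for m
    unfolding mu_def
  proof (rule norm_midpoint_one_less_one)
    show "cmod (lam m / lam n) \<le> 1"
      using m n by (auto simp: B_def norm_divide)
    show "lam m / lam n \<noteq> 1"
      using m n inj_onD[OF inj_on_lam, of m n] by auto
  qed
  \<comment> \<open>As \<open>mu n = 1\<close>, the term of index \<open>n\<close> equals
    \<open>P n g\<close> for every \<open>k\<close>. Subtracting it leaves a series whose
    multipliers are powers of numbers of modulus below one.\<close>
  have "(\<lambda>k. (T ^^ k) y - P n g) \<longlonglongrightarrow> 0"
  proof (rule orthogonal_series_tendsto_zero)
    show "orthogonal_family (\<lambda>m. P m g) (S - B - {n})"
      using orthogonal_family_projections by (rule pairwise_subset) blast
    show "((\<lambda>m. P m g) has_sum y - (\<Sum>m\<in>{n}. P m g)) (S - B - {n})"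
      using y_sum n B by (intro has_sum_Diff has_sum_finite) auto
    show "cmod (mu m ^ k) \<le> 1" if "m \<in> S - B - {n}" for m k
      using mu_less[OF that] by (simp add: norm_power power_le_one)
    show "(\<lambda>k. mu m ^ k) \<longlonglongrightarrow> 0" if "m \<in> S - B - {n}" for m
      using mu_less[OF that] by (rule LIMSEQ_power_zero)
    have "((\<lambda>m. mu m ^ k *\<^sub>C P m g) has_sum (T ^^ k) y - (\<Sum>m\<in>{n}. mu m ^ k *\<^sub>C P m g))
      (S - B - {n})" for k
      using powers_sum n B by (intro has_sum_Diff has_sum_finite) auto
    then show "((\<lambda>m. mu m ^ k *\<^sub>C P m g) has_sum (T ^^ k) y - P n g) (S - B - {n})" for k
      by (simp add: mu_n)
  qed
  then have "(\<lambda>k. (T ^^ k) y) \<longlonglongrightarrow> P n g"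
    by (rule LIM_zero_cancel)
  with powers_M show ?case
    by (rule closed_sequentially[OF closed_closure])
qed

text \<open>Every generator, including \<open>g\<close> itself for \<open>k = 0\<close>, lies in the
  range of \<open>A\<close> and so is orthogonal to \<open>y\<close>; the vectors orthogonal to
  \<open>y\<close> form a closed subspace.\<close>

lemma krylov_orthogonal_kernel:
  assumes "g \<in> range A" "f \<in> closure (krylov_subspace A g)" "A y = 0"
  shows "cinner y f = 0"
proof -
  have "(A ^^ k) g \<in> range A" for k
    using assms(1) by (cases k) auto
  then have "cinner y ((A ^^ k) g) = 0" for k
    using range_orthogonal_kernel[OF assms(3)] by (metis imageE)
  then have "krylov_subspace A g \<subseteq> {x. cinner y x = 0}"
    by (intro krylov_subspace_minimal complex_vector.subspaceI)
      (auto simp: cinner_zero_right cinner_add_right cinner_scaleC_right)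
  then have "closure (krylov_subspace A g) \<subseteq> {x. cinner y x = 0}"
    using closed_orthogonal by (rule closure_minimal)
  then show ?thesis
    using assms(2) by blast
qed

section \<open>Uniqueness, minimal norm and existence of the Krylov solution\<close>

lemma solution_diff:
  assumes "A f = g" "A f' = g"
  shows "A (f' - f) = 0"
  using assms linear_diff[OF bounded_linear.linear[OF bounded_clinear_bounded_linear[OF bounded]]]
  by simp

text \<open>The difference of two Krylov solutions lies both in the closed Krylov subspace and in
  the kernel, hence is orthogonal to itself.\<close>

lemma krylov_solution_unique:
  assumes "krylov_solution A g f" "krylov_solution A g f'"
  shows "f = f'"
proof -
  have f: "A f = g" "f \<in> closure (krylov_subspace A g)"
    and f': "A f' = g" "f' \<in> closure (krylov_subspace A g)"
    using assms by (auto simp: krylov_solution_def)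
  have "f' - f \<in> closure (krylov_subspace A g)"
    using subspace_closure_krylov f'(2) f(2) by (rule complex_vector.subspace_diff)
  then have "cinner (f' - f) (f' - f) = 0"
    using f(1) krylov_orthogonal_kernel[OF _ _ solution_diff[OF f(1) f'(1)]] by blast
  then show ?thesis
    by (simp add: cinner_self_eq_zero_iff)
qed

text \<open>Any other solution differs from \<open>f\<close> by a kernel vector, which is orthogonal
  to \<open>f\<close>, so Pythagoras applies.\<close>

lemma krylov_solution_minimal_norm:
  assumes "krylov_solution A g f" "A f' = g"
  shows "norm f \<le> norm f'"
proof -
  have f: "A f = g" "f \<in> closure (krylov_subspace A g)"
    using assms by (auto simp: krylov_solution_def)
  have "cinner (f' - f) f = 0"
    using f krylov_orthogonal_kernel[OF _ _ solution_diff[OF f(1) assms(2)]] by blast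
  then have "norm f \<le> norm (f + (f' - f))"
    by (intro norm_le_norm_add_orthogonal) (simp add: cinner_eq_zero_sym[of f])
  then show ?thesis by simp
qed

lemma krylov_solution_exists:
  assumes "g \<in> range A"
  shows "\<exists>f. krylov_solution A g f \<and> ((\<lambda>n. (1 / lam n) *\<^sub>C P n g) has_sum f) (S - {0})"
proof -
  obtain f where f: "A f = g" using assms by blast
  \<comment> \<open>Removing the kernel component from an arbitrary solution leaves it a solution
    and deletes exactly the term of index \<open>0\<close>, the one that \<open>g\<close> does not
    determine.\<close>
  define f0 where "f0 = f - P 0 f"
  have "((\<lambda>n. P n f) has_sum f - (\<Sum>n\<in>{0}. P n f)) (S - {0})"
    using has_sum_projections zero_index by (intro has_sum_Diff has_sum_finite) auto
  then have "((\<lambda>n. P n f) has_sum f0) (S - {0})"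
    by (simp add: f0_def)
  moreover have "(1 / lam n) *\<^sub>C P n g = P n f" if "n \<in> S - {0}" for n
    using that lam_nonzero[OF that] projection_A[of n f] f by simp
  ultimately have sum: "((\<lambda>n. (1 / lam n) *\<^sub>C P n g) has_sum f0) (S - {0})"
    using has_sum_cong[of "S - {0}" "\<lambda>n. (1 / lam n) *\<^sub>C P n g" "\<lambda>n. P n f"] by blast
  have "A (P 0 f) = 0"
    by (simp add: A_projection zero_index)
  then have "A f0 = g"
    using f linear_diff[OF bounded_linear.linear[OF bounded_clinear_bounded_linear[OF bounded]]]
    by (simp add: f0_def)
  \<comment> \<open>Each term of the series is a multiple of some \<open>P n g\<close> with
    \<open>n\<close> non-zero, and the closed Krylov subspace contains the sums of convergent series
    of its elements.\<close>
  moreover have "f0 \<in> closure (krylov_subspace A g)"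
    using subspace_closure_krylov closed_closure sum
    by (rule has_sum_in_closed_subspace)
      (intro complex_vector.subspace_scale[OF subspace_closure_krylov] projection_in_closure_krylov)
  ultimately show ?thesis
    using sum by (auto simp: krylov_solution_def)
qed

end

theorem proposition3p4:
  fixes A :: "'a::complex_hilbert_space \<Rightarrow> 'a" and g :: 'a
    and S :: "nat set" and lam :: "nat \<Rightarrow> complex" and P :: "nat \<Rightarrow> 'a \<Rightarrow> 'a"
  assumes "bounded_clinear A"
    and "compact_operator A"
    and "normal_operator A"
    and "canonical_decomposition A S lam P"
    and "g \<in> range A"
  shows "(\<exists>!f\<^sub>0. krylov_solution A g f\<^sub>0) \<and>
    (\<forall>f\<^sub>0. krylov_solution A g f\<^sub>0 \<longrightarrow>
      (\<forall>f. A f = g \<longrightarrow> norm f\<^sub>0 \<le> norm f) \<and>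
      (A \<noteq> (\<lambda>x. 0) \<longrightarrow> ((\<lambda>n. (1 / lam n) *\<^sub>C P n g) has_sum f\<^sub>0) (S - {0})))"
proof -
  interpret canonically_decomposed A S lam P
    using assms(1,4) by unfold_locales
  obtain f where f: "krylov_solution A g f"
    "((\<lambda>n. (1 / lam n) *\<^sub>C P n g) has_sum f) (S - {0})"
    using krylov_solution_exists[OF assms(5)] by blast
  \<comment> \<open>Rewriting with this equivalence reduces the claims about all Krylov solutions to
    claims about the constructed \<open>f\<close>.\<close>
  have unique: "krylov_solution A g f' \<longleftrightarrow> f' = f" for f'
    using krylov_solution_unique[OF _ f(1)] f(1) by blast
  show ?thesis
    using f(2) krylov_solution_minimal_norm[OF f(1)] by (simp add: unique)
qed

end
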